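(* Let $\Gamma=\forall x\forall y:\phi(x,y)\wedge\bigwedge_{k\in[m]}\forall x\exists y:\beta_k(x,y)$ be an $\mathbf{FO}^2$ sentence in Scott normal form and $\Delta=\{e_1,\dots,e_n\}$ a finite non-empty domain. Fix a pair $(i,j)$. Let $C$ and $C'$ be the circuits returned by the calls $\textsc{Stage-II}((i,j),\theta)$ and $\textsc{Stage-II}((i,j),\theta')$ of the Two-Stage Compilation algorithm (described in the context), respectively. If - $S_\theta=S_{\theta'}$; and - for any unprocessed pair of elements $(e_\ell,e_t)$, $\mathcal B(\tau_\ell,\tau_t)=\mathcal B(\tau'_\ell,\tau'_t)$, where $\tau_\ell,\tau_t$ (resp. $\tau'_\ell,\tau'_t$) are the unary types of $e_\ell,e_t$ in $\theta$ (resp. in $\theta'$), then $C$ and $C'$ are equivalent (have the same satisfying assignments).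
   Context: Logic. First-order logic is function-free, constant-free and without equality. Vocabularies are finite, with predicates of arity 1 or 2. In the Scott normal form, $\phi$ is quantifier-free with variables among $x,y$ and each $\beta_k(x,y)$ is a single binary atom. Ground atoms over $\Delta$ are the propositional variables. Circuits. An NNF circuit is a labelled DAG with internal nodes $\wedge,\vee$, leaves that are literals (or the constants $\top,\bot$), and a unique output node. Types. A unary type $\tau$ is a maximally consistent set of literals over the atoms $P(x)$ ($P$ unary in $\Gamma$) and $R(x,x)$ ($R$ binary in $\Gamma$). A binary type $\pi$ is a maximally consistent set of literals over the atoms $R(x,y),R(y,x)$ ($R$ binary in $\Gamma$). Types are identified with the conjunctions $\tau(x)$, $\pi(x,y)$ of their literals. $\tau$ is valid if $\tau(x)\models\phi(x,x)$; $\mathcal U$ is the set of valid unary types. For $\tau,\tau'\in\mathcal U$, $\mathcal B(\tau,\tau')$ is the set of binary types $\pi$ with $\tau(x)\wedge\tau'(y)\wedge\pi(x,y)\models\phi(x,y)\wedge\phi(y,x)$. Algorithm. A context $\theta$ is the conjunction of the ground type formulas chosen so far along the current recursion branch. $\textsc{Extendable}(\theta)$ holds iff there is a model $\mathcal A$ over $\Delta$ with $\mathcal A\models\Gamma\wedge\theta$. $\textsc{Or}(S)$ and $\textsc{And}(S)$ create an $\vee$-node (resp. $\wedge$-node) with children $S$; empty $\textsc{Or}$ is $\bot$ and empty $\textsc{And}$ is $\top$. Two-Stage Compilation returns $\textsc{Stage-I}(1,\top)$, where: - $\textsc{Stage-I}(i,\theta)$: if $i=n+1$, return $\textsc{Stage-II}((1,2),\theta)$.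 Otherwise return $\textsc{Or}$ of the set of all nodes $\textsc{And}(\textsc{And}(\tau(e_i)),\textsc{Stage-I}(i+1,\theta\wedge\tau(e_i)))$, over all $\tau\in\mathcal U$ for which $\textsc{Extendable}(\theta\wedge\tau(e_i))$ holds, where $\textsc{And}(\tau(e_i))$ is the $\wedge$-node over the literals of $\tau(e_i)$. - $\textsc{Stage-II}((i,j),\theta)$: if $i=n$, return $\top$. Otherwise let $\tau_i,\tau_j$ be the unary types assigned to $e_i,e_j$ in $\theta$ and return $\textsc{Or}$ of the set of all nodes $\textsc{And}(\textsc{And}(\pi(e_i,e_j)),\textsc{Stage-II}(\mathrm{next}(i,j),\theta\wedge\pi(e_i,e_j)))$, over all $\pi\in\mathcal B(\tau_i,\tau_j)$ for which $\textsc{Extendable}(\theta\wedge\pi(e_i,e_j))$ holds. Here $\mathrm{next}(i,j)=(i,j+1)$ if $j<n$ and $(i+1,i+2)$ if $j=n$. Recursive calls are made only for contexts passing the $\textsc{Extendable}$ test. Thus the context $\theta$ of a call $\textsc{Stage-II}((i,j),\theta)$ assigns a valid unary type to every element of $\Delta$, and a valid binary type to every pair $(e_\ell,e_t)$, $\ell<t$, with $(\ell,t)$ lexicographically smaller than $(i,j)$. The unprocessed pairs are the pairs $(e_\ell,e_t)$, $\ell<t$, with $(\ell,t)$ lexicographically at least $(i,j)$. Satisfaction state. $S_\theta$ is the $n\times m$ Boolean matrix with $S_\theta(\ell,k)=\mathrm{True}$ iff there exists $e_t\in\Delta$ (possibly $t=\ell$) with $\theta\models\beta_k(e_\ell,e_t)$.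 *)

theory Defs
  imports Main "HOL-Library.FSet"
begin

section \<open>Two-variable first-order logic\<close>

datatype var = Vx | Vy

datatype (unary_preds_atom: 'u, binary_preds_atom: 'b, terms_atom: 't) atom =
    is_Unary: Unary 'u 't
  | is_Binary: Binary 'b 't 't

datatype (unary_preds: 'u, binary_preds: 'b) fo2 =
    Verum
  | Falsum
  | Atom "('u, 'b, var) atom"
  | Neg "('u, 'b) fo2"
  | Conj "('u, 'b) fo2" "('u, 'b) fo2"
  | Disj "('u, 'b) fo2" "('u, 'b) fo2"
  | Forall var "('u, 'b) fo2"
  | Exists var "('u, 'b) fo2"

definition inst :: "('s \<Rightarrow> 't) \<Rightarrow> ('u, 'b, 's) atom \<Rightarrow> ('u, 'b, 't) atom" where
  "inst s = map_atom id id s"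

text \<open>
  A structure is given by its domain \<open>D\<close> together with the truth values \<open>A\<close> of the
  ground atoms; only the values of atoms over \<open>D\<close> matter.
\<close>

primrec sat :: "'e set \<Rightarrow> (('u, 'b, 'e) atom \<Rightarrow> bool) \<Rightarrow> (var \<Rightarrow> 'e) \<Rightarrow> ('u, 'b) fo2 \<Rightarrow> bool" where
  "sat D A s Verum \<longleftrightarrow> True"
| "sat D A s Falsum \<longleftrightarrow> False"
| "sat D A s (Atom a) \<longleftrightarrow> A (inst s a)"
| "sat D A s (Neg F) \<longleftrightarrow> \<not> sat D A s F"
| "sat D A s (Conj F G) \<longleftrightarrow> sat D A s F \<and> sat D A s G"
| "sat D A s (Disj F G) \<longleftrightarrow> sat D A s F \<or> sat D A s G"
| "sat D A s (Forall v F) \<longleftrightarrow> (\<forall>d\<in>D. sat D A (s(v := d)) F)"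
| "sat D A s (Exists v F) \<longleftrightarrow> (\<exists>d\<in>D. sat D A (s(v := d)) F)"

definition models :: "'e set \<Rightarrow> (('u, 'b, 'e) atom \<Rightarrow> bool) \<Rightarrow> ('u, 'b) fo2 \<Rightarrow> bool" where
  "models D A F \<longleftrightarrow> (\<forall>s. range s \<subseteq> D \<longrightarrow> sat D A s F)"

fun quantifier_free :: "('u, 'b) fo2 \<Rightarrow> bool" where
  "quantifier_free (Neg F) \<longleftrightarrow> quantifier_free F"
| "quantifier_free (Conj F G) \<longleftrightarrow> quantifier_free F \<and> quantifier_free G"
| "quantifier_free (Disj F G) \<longleftrightarrow> quantifier_free F \<and> quantifier_free G"
| "quantifier_free (Forall v F) \<longleftrightarrow> False"
| "quantifier_free (Exists v F) \<longleftrightarrow> False"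
| "quantifier_free _ \<longleftrightarrow> True"

text \<open>
  A sentence in Scott normal form is presented by its matrix \<open>\<phi>\<close> and the list of the
  atoms \<open>\<beta>\<^sub>k\<close>; thus \<open>m\<close> is the length of the list, and \<open>k\<close> is counted from \<open>0\<close>.
\<close>

record ('u, 'b) scott =
  matrix :: "('u, 'b) fo2"
  witnesses :: "('u, 'b, var) atom list"

definition scott_normal_form :: "('u, 'b) scott \<Rightarrow> bool" where
  "scott_normal_form \<Gamma> \<longleftrightarrow>
     quantifier_free (matrix \<Gamma>) \<and> (\<forall>\<beta> \<in> set (witnesses \<Gamma>). is_Binary \<beta>)"

definition sentence :: "('u, 'b) scott \<Rightarrow> ('u, 'b) fo2" where
  "sentence \<Gamma> = foldl Conj (Forall Vx (Forall Vy (matrix \<Gamma>)))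
     (map (\<lambda>\<beta>. Forall Vx (Exists Vy (Atom \<beta>))) (witnesses \<Gamma>))"

section \<open>Types\<close>

datatype 'a literal = Pos 'a | NegL 'a

primrec holds :: "('a \<Rightarrow> bool) \<Rightarrow> 'a literal \<Rightarrow> bool" where
  "holds v (Pos a) \<longleftrightarrow> v a"
| "holds v (NegL a) \<longleftrightarrow> \<not> v a"

definition literals :: "'a set \<Rightarrow> 'a literal set" where
  "literals As = Pos ` As \<union> NegL ` As"

definition consistent :: "'a literal set \<Rightarrow> bool" where
  "consistent L \<longleftrightarrow> (\<exists>v. \<forall>l\<in>L. holds v l)"

definition maximally_consistent :: "'a set \<Rightarrow> 'a literal set \<Rightarrow> bool" where
  "maximally_consistent As L \<longleftrightarrow> L \<subseteq> literals As \<and> consistent L \<and>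
     (\<forall>L'. L \<subseteq> L' \<and> L' \<subseteq> literals As \<and> consistent L' \<longrightarrow> L' = L)"

definition unary_type_atoms :: "('u, 'b) fo2 \<Rightarrow> ('u, 'b, var) atom set" where
  "unary_type_atoms F =
     (\<lambda>P. Unary P Vx) ` unary_preds F \<union> (\<lambda>R. Binary R Vx Vx) ` binary_preds F"

definition binary_type_atoms :: "('u, 'b) fo2 \<Rightarrow> ('u, 'b, var) atom set" where
  "binary_type_atoms F =
     (\<lambda>R. Binary R Vx Vy) ` binary_preds F \<union> (\<lambda>R. Binary R Vy Vx) ` binary_preds F"

type_synonym ('u, 'b) type_lits = "('u, 'b, var) atom literal set"

definition unary_type :: "('u, 'b) scott \<Rightarrow> ('u, 'b) type_lits \<Rightarrow> bool" where
  "unary_type \<Gamma> = maximally_consistent (unary_type_atoms (sentence \<Gamma>))"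

definition binary_type :: "('u, 'b) scott \<Rightarrow> ('u, 'b) type_lits \<Rightarrow> bool" where
  "binary_type \<Gamma> = maximally_consistent (binary_type_atoms (sentence \<Gamma>))"

text \<open>\<open>assign a b\<close> is the assignment \<open>x \<mapsto> a\<close>, \<open>y \<mapsto> b\<close>.\<close>

definition assign :: "'t \<Rightarrow> 't \<Rightarrow> var \<Rightarrow> 't" where
  "assign a b v = (case v of Vx \<Rightarrow> a | Vy \<Rightarrow> b)"

text \<open>The sets of literals of \<open>\<tau>(a)\<close> and of \<open>\<pi>(a,b)\<close>.\<close>

definition inst1 :: "('u, 'b) type_lits \<Rightarrow> 't \<Rightarrow> ('u, 'b, 't) atom literal set" where
  "inst1 \<tau> a = map_literal (inst (assign a a)) ` \<tau>"

definition inst2 :: "('u, 'b) type_lits \<Rightarrow> 't \<Rightarrow> 't \<Rightarrow> ('u, 'b, 't) atom literal set" where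
  "inst2 \<pi> a b = map_literal (inst (assign a b)) ` \<pi>"

text \<open>
  Entailment between open formulas: truth of the premise at a choice of elements for \<open>x\<close>, \<open>y\<close>
  (not necessarily distinct) implies truth of the conclusion there, in every structure.
  Structures with domain a set of naturals suffice, because HOL cannot quantify over types in
  a formula and the truth value of a quantifier-free formula only depends on the elements
  assigned to \<open>x\<close> and \<open>y\<close>.
\<close>

definition valid_unary_types :: "('u, 'b) scott \<Rightarrow> ('u, 'b) type_lits set" where
  "valid_unary_types \<Gamma> = {\<tau>. unary_type \<Gamma> \<tau> \<and>
     (\<forall>(D :: nat set) A. \<forall>a\<in>D.
        (\<forall>l \<in> inst1 \<tau> a. holds A l) \<longrightarrow> sat D A (assign a a) (matrix \<Gamma>))}"

definition valid_binary_types ::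
  "('u, 'b) scott \<Rightarrow> ('u, 'b) type_lits \<Rightarrow> ('u, 'b) type_lits \<Rightarrow> ('u, 'b) type_lits set" where
  "valid_binary_types \<Gamma> \<tau> \<tau>' = {\<pi>. binary_type \<Gamma> \<pi> \<and>
     (\<forall>(D :: nat set) A. \<forall>a\<in>D. \<forall>b\<in>D.
        (\<forall>l \<in> inst1 \<tau> a \<union> inst1 \<tau>' b \<union> inst2 \<pi> a b. holds A l) \<longrightarrow>
        sat D A (assign a b) (matrix \<Gamma>) \<and> sat D A (assign b a) (matrix \<Gamma>))}"

section \<open>NNF circuits\<close>

text \<open>
  A value of this type is a node of a circuit, whose set of children is part of the node. The
  circuit with output \<open>C\<close> is the directed acyclic graph of all nodes reachable from \<open>C\<close>; a node
  reachable along several paths is shared, as equal nodes are the same node.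
\<close>

datatype 'a nnf =
    Lit "'a literal"
  | Top
  | Bot
  | And_node "'a nnf fset"
  | Or_node "'a nnf fset"

primrec nnf_sat :: "('a \<Rightarrow> bool) \<Rightarrow> 'a nnf \<Rightarrow> bool" where
  "nnf_sat v (Lit l) \<longleftrightarrow> holds v l"
| "nnf_sat v Top \<longleftrightarrow> True"
| "nnf_sat v Bot \<longleftrightarrow> False"
| "nnf_sat v (And_node S) \<longleftrightarrow> (\<forall>b |\<in>| nnf_sat v |`| S. b)"
| "nnf_sat v (Or_node S) \<longleftrightarrow> (\<exists>b |\<in>| nnf_sat v |`| S. b)"

definition equivalent :: "'a nnf \<Rightarrow> 'a nnf \<Rightarrow> bool" where
  "equivalent C C' \<longleftrightarrow> {v. nnf_sat v C} = {v. nnf_sat v C'}"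

text \<open>
  The following two functions are only meaningful for finite \<open>S\<close>. All sets they are applied to
  below are finite, by the \<open>finite_valid\<close> lemmas.
\<close>

definition mk_And :: "'a nnf set \<Rightarrow> 'a nnf" where
  "mk_And S = (if S = {} then Top else And_node (Abs_fset S))"

definition mk_Or :: "'a nnf set \<Rightarrow> 'a nnf" where
  "mk_Or S = (if S = {} then Bot else Or_node (Abs_fset S))"

lemma finite_preds: "finite (unary_preds F)" "finite (binary_preds F)"
proof -
  have "finite (unary_preds_atom a)" "finite (binary_preds_atom a)" for a :: "('a, 'b, var) atom"
    by (cases a; simp)+
  then show "finite (unary_preds F)" "finite (binary_preds F)"
    by (induction F) auto
qed

lemma finite_maximally_consistent:
  assumes "finite As"
  shows "finite {L. maximally_consistent As L}"
proof (rule finite_subset)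
  show "{L. maximally_consistent As L} \<subseteq> Pow (literals As)"
    by (auto simp: maximally_consistent_def)
  show "finite (Pow (literals As))"
    using assms by (simp add: literals_def)
qed

lemma finite_valid_unary_types: "finite (valid_unary_types \<Gamma>)"
  unfolding valid_unary_types_def unary_type_def
  by (rule finite_subset[OF _ finite_maximally_consistent])
    (auto simp: unary_type_atoms_def finite_preds)

lemma finite_valid_binary_types: "finite (valid_binary_types \<Gamma> \<tau> \<tau>')"
  unfolding valid_binary_types_def binary_type_def
  by (rule finite_subset[OF _ finite_maximally_consistent])
    (auto simp: binary_type_atoms_def finite_preds)

lemma finite_if_maximally_consistent:
  assumes "finite As" and "maximally_consistent As L"
  shows "finite L"
proof (rule finite_subset)
  show "L \<subseteq> literals As"
    using assms(2) by (simp add: maximally_consistent_def)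
  show "finite (literals As)"
    using assms(1) by (simp add: literals_def)
qed

lemma finite_valid_type:
  "\<tau> \<in> valid_unary_types \<Gamma> \<Longrightarrow> finite \<tau>"
  "\<pi> \<in> valid_binary_types \<Gamma> \<tau>' \<tau>'' \<Longrightarrow> finite \<pi>"
  using finite_if_maximally_consistent[of "unary_type_atoms (sentence \<Gamma>)" \<tau>]
    finite_if_maximally_consistent[of "binary_type_atoms (sentence \<Gamma>)" \<pi>]
  by (simp_all add: valid_unary_types_def valid_binary_types_def unary_type_def binary_type_def
      unary_type_atoms_def binary_type_atoms_def finite_preds)

section \<open>Two-stage compilation\<close>

text \<open>
  The domain is \<open>{e 1, \<dots>, e n}\<close>. A context, being a conjunction of ground type formulas, is
  represented by the set of its literals.
\<close>

type_synonym ('u, 'b, 'e) ctxt = "('u, 'b, 'e) atom literal set"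

definition extendable ::
  "('u, 'b) scott \<Rightarrow> (nat \<Rightarrow> 'e) \<Rightarrow> nat \<Rightarrow> ('u, 'b, 'e) ctxt \<Rightarrow> bool" where
  "extendable \<Gamma> e n \<theta> \<longleftrightarrow>
     (\<exists>A. models (e ` {1..n}) A (sentence \<Gamma>) \<and> (\<forall>l\<in>\<theta>. holds A l))"

text \<open>The unary type \<open>\<tau>\<close> with \<open>\<tau>(a)\<close> among the conjuncts of \<open>\<theta>\<close>.\<close>

definition type_in :: "('u, 'b) scott \<Rightarrow> ('u, 'b, 'e) ctxt \<Rightarrow> 'e \<Rightarrow> ('u, 'b) type_lits" where
  "type_in \<Gamma> \<theta> a =
     {l \<in> literals (unary_type_atoms (sentence \<Gamma>)). map_literal (inst (assign a a)) l \<in> \<theta>}"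

definition next_pair :: "nat \<Rightarrow> nat \<times> nat \<Rightarrow> nat \<times> nat" where
  "next_pair n = (\<lambda>(i, j). if j < n then (i, j + 1) else (i + 1, i + 2))"

text \<open>
  The calls made by the algorithm satisfy \<open>i \<le> n + 1\<close> in stage I, and \<open>i < j \<le> n\<close> or
  \<open>(i, j) = (n, n + 1)\<close> in stage II. Hence the tests \<open>n < i\<close>, \<open>n \<le> i\<close> (and \<open>n \<le> j\<close> in
  \<open>next_pair\<close>) amount to \<open>i = n + 1\<close>, \<open>i = n\<close> and \<open>j = n\<close>; they make the recursion total.
\<close>

function (sequential) stage2 ::
  "('u, 'b) scott \<Rightarrow> (nat \<Rightarrow> 'e) \<Rightarrow> nat \<Rightarrow> nat \<times> nat \<Rightarrow> ('u, 'b, 'e) ctxt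
     \<Rightarrow> ('u, 'b, 'e) atom nnf" where
  "stage2 \<Gamma> e n (i, j) \<theta> =
     (if n \<le> i then Top
      else mk_Or ((\<lambda>\<pi>. mk_And {mk_And (Lit ` inst2 \<pi> (e i) (e j)),
                               stage2 \<Gamma> e n (next_pair n (i, j)) (\<theta> \<union> inst2 \<pi> (e i) (e j))})
             ` {\<pi> \<in> valid_binary_types \<Gamma> (type_in \<Gamma> \<theta> (e i)) (type_in \<Gamma> \<theta> (e j)).
                  extendable \<Gamma> e n (\<theta> \<union> inst2 \<pi> (e i) (e j))}))"
  by pat_completeness auto
termination
  by (relation "measures [\<lambda>(\<Gamma>, e, n, (i, j), \<theta>). n - i, \<lambda>(\<Gamma>, e, n, (i, j), \<theta>). n - j]")
    (auto simp: next_pair_def)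

function (sequential) stage1 ::
  "('u, 'b) scott \<Rightarrow> (nat \<Rightarrow> 'e) \<Rightarrow> nat \<Rightarrow> nat \<Rightarrow> ('u, 'b, 'e) ctxt
     \<Rightarrow> ('u, 'b, 'e) atom nnf" where
  "stage1 \<Gamma> e n i \<theta> =
     (if n < i then stage2 \<Gamma> e n (1, 2) \<theta>
      else mk_Or ((\<lambda>\<tau>. mk_And {mk_And (Lit ` inst1 \<tau> (e i)),
                               stage1 \<Gamma> e n (i + 1) (\<theta> \<union> inst1 \<tau> (e i))})
             ` {\<tau> \<in> valid_unary_types \<Gamma>. extendable \<Gamma> e n (\<theta> \<union> inst1 \<tau> (e i))}))"
  by pat_completeness auto
termination
  by (relation "measure (\<lambda>(\<Gamma>, e, n, i, \<theta>). Suc n - i)") auto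

declare stage1.simps [simp del] stage2.simps [simp del]

definition two_stage_compilation ::
  "('u, 'b) scott \<Rightarrow> (nat \<Rightarrow> 'e) \<Rightarrow> nat \<Rightarrow> ('u, 'b, 'e) atom nnf" where
  "two_stage_compilation \<Gamma> e n = stage1 \<Gamma> e n 1 {}"

text \<open>The arguments of the recursive calls made while computing \<open>two_stage_compilation \<Gamma> e n\<close>.\<close>

inductive stage1_call ::
  "('u, 'b) scott \<Rightarrow> (nat \<Rightarrow> 'e) \<Rightarrow> nat \<Rightarrow> nat \<Rightarrow> ('u, 'b, 'e) ctxt \<Rightarrow> bool"
  for \<Gamma> e n where
  "stage1_call \<Gamma> e n 1 {}"
| "\<lbrakk>stage1_call \<Gamma> e n i \<theta>; i \<le> n; \<tau> \<in> valid_unary_types \<Gamma>;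
    extendable \<Gamma> e n (\<theta> \<union> inst1 \<tau> (e i))\<rbrakk>
   \<Longrightarrow> stage1_call \<Gamma> e n (i + 1) (\<theta> \<union> inst1 \<tau> (e i))"

inductive stage2_call ::
  "('u, 'b) scott \<Rightarrow> (nat \<Rightarrow> 'e) \<Rightarrow> nat \<Rightarrow> nat \<times> nat \<Rightarrow> ('u, 'b, 'e) ctxt \<Rightarrow> bool"
  for \<Gamma> e n where
  "stage1_call \<Gamma> e n (n + 1) \<theta> \<Longrightarrow> stage2_call \<Gamma> e n (1, 2) \<theta>"
| "\<lbrakk>stage2_call \<Gamma> e n (i, j) \<theta>; i < n;
    \<pi> \<in> valid_binary_types \<Gamma> (type_in \<Gamma> \<theta> (e i)) (type_in \<Gamma> \<theta> (e j));
    extendable \<Gamma> e n (\<theta> \<union> inst2 \<pi> (e i) (e j))\<rbrakk>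
   \<Longrightarrow> stage2_call \<Gamma> e n (next_pair n (i, j)) (\<theta> \<union> inst2 \<pi> (e i) (e j))"

definition unprocessed :: "nat \<Rightarrow> nat \<times> nat \<Rightarrow> (nat \<times> nat) set" where
  "unprocessed n = (\<lambda>(i, j).
     {(l, t). 1 \<le> l \<and> l < t \<and> t \<le> n \<and> (i < l \<or> i = l \<and> j \<le> t)})"

definition entails_atom :: "'a literal set \<Rightarrow> 'a \<Rightarrow> bool" where
  "entails_atom L a \<longleftrightarrow> (\<forall>v. (\<forall>l\<in>L. holds v l) \<longrightarrow> v a)"

definition satisfaction_state ::
  "('u, 'b) scott \<Rightarrow> (nat \<Rightarrow> 'e) \<Rightarrow> nat \<Rightarrow> ('u, 'b, 'e) ctxt \<Rightarrow> nat \<Rightarrow> nat \<Rightarrow> bool" where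
  "satisfaction_state \<Gamma> e n \<theta> l k \<longleftrightarrow>
     (\<exists>t\<in>{1..n}. entails_atom \<theta> (inst (assign (e l) (e t)) (witnesses \<Gamma> ! k)))"

end

theory Submission
  imports Defs
begin

text \<open>
  A call of stage II with context \<open>\<theta>\<close> returns a circuit satisfied by exactly those valuations that
  agree, on the atoms of the unprocessed pairs, with some model of \<open>\<Gamma> \<and> \<theta>\<close>. Given two contexts
  as in the theorem, a model of \<open>\<Gamma> \<and> \<theta>\<close> is turned into one of \<open>\<Gamma> \<and> \<theta>'\<close> by keeping it on the
  unprocessed pairs and replacing it by a model of \<open>\<Gamma> \<and> \<theta>'\<close> elsewhere: equal sets of valid binary
  types preserve the universal part, and equal satisfaction states preserve the witnesses that do
  not come from unprocessed pairs.
\<close>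

section \<open>Semantics of sentences and circuits\<close>

lemma inst_simps [simp]:
  "inst s (Unary P t) = Unary P (s t)"
  "inst s (Binary R t u) = Binary R (s t) (s u)"
  by (simp_all add: inst_def)

lemma assign_simps [simp]: "assign a b Vx = a" "assign a b Vy = b"
  by (simp_all add: assign_def)

lemma fun_upd_eq_assign: "s(Vx := a, Vy := b) = assign a b"
proof
  show "(s(Vx := a, Vy := b)) v = assign a b v" for v
    by (cases v) simp_all
qed

text \<open>Without quantifiers the domain is never consulted, so \<open>D\<close> and
  \<open>D'\<close> are unrelated and may even be sets over different types. This permits comparison
  with the structures on naturals over which validity of types is defined.\<close>

lemma sat_cong:
  assumes "quantifier_free F"
    and "\<And>P v. P \<in> unary_preds F \<Longrightarrow> A (Unary P (s v)) \<longleftrightarrow> A' (Unary P (s' v))"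
    and "\<And>R v w. R \<in> binary_preds F \<Longrightarrow> A (Binary R (s v) (s w)) \<longleftrightarrow> A' (Binary R (s' v) (s' w))"
  shows "sat D A s F \<longleftrightarrow> sat D' A' s' F"
  using assms
proof (induction F)
  case (Atom a)
  then show ?case by (cases a) auto
qed auto

lemma sat_foldl_Conj: "sat D A s (foldl Conj F Gs) \<longleftrightarrow> sat D A s F \<and> (\<forall>G\<in>set Gs. sat D A s G)"
  by (induction Gs arbitrary: F) auto

lemma preds_foldl_Conj:
  "unary_preds (foldl Conj F Gs) = unary_preds F \<union> (\<Union>G\<in>set Gs. unary_preds G)"
  "binary_preds (foldl Conj F Gs) = binary_preds F \<union> (\<Union>G\<in>set Gs. binary_preds G)"
  by (induction Gs arbitrary: F) auto

lemma preds_matrix: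
  "unary_preds (matrix \<Gamma>) \<subseteq> unary_preds (sentence \<Gamma>)"
  "binary_preds (matrix \<Gamma>) \<subseteq> binary_preds (sentence \<Gamma>)"
  by (auto simp: sentence_def preds_foldl_Conj)

lemma preds_witness: "Binary R t u \<in> set (witnesses \<Gamma>) \<Longrightarrow> R \<in> binary_preds (sentence \<Gamma>)"
  by (force simp: sentence_def preds_foldl_Conj)

lemma sat_matrix_cong:
  assumes "quantifier_free (matrix \<Gamma>)"
    and "\<And>P v. P \<in> unary_preds (sentence \<Gamma>) \<Longrightarrow> A (Unary P (s v)) \<longleftrightarrow> A' (Unary P (s' v))"
    and "\<And>R v w. R \<in> binary_preds (sentence \<Gamma>) \<Longrightarrow>
           A (Binary R (s v) (s w)) \<longleftrightarrow> A' (Binary R (s' v) (s' w))"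
  shows "sat D A s (matrix \<Gamma>) \<longleftrightarrow> sat D' A' s' (matrix \<Gamma>)"
  using assms preds_matrix[of \<Gamma>] by (intro sat_cong) auto

lemma models_sentence:
  assumes "D \<noteq> {}"
  shows "models D A (sentence \<Gamma>) \<longleftrightarrow>
    (\<forall>a\<in>D. \<forall>b\<in>D. sat D A (assign a b) (matrix \<Gamma>)) \<and>
    (\<forall>\<beta>\<in>set (witnesses \<Gamma>). \<forall>a\<in>D. \<exists>b\<in>D. A (inst (assign a b) \<beta>))"
proof -
  obtain d where "d \<in> D"
    using assms by blast
  then have "\<exists>s. range s \<subseteq> D"
    by (intro exI[of _ "\<lambda>_. d"]) auto
  then show ?thesis
    by (auto simp: models_def sentence_def sat_foldl_Conj fun_upd_eq_assign)
qed

section \<open>Semantics of the circuit constructors\<close>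

lemma nnf_sat_mk_And: "finite S \<Longrightarrow> nnf_sat v (mk_And S) \<longleftrightarrow> (\<forall>C\<in>S. nnf_sat v C)"
  by (auto simp: mk_And_def Abs_fset_inverse)

lemma nnf_sat_mk_Or: "finite S \<Longrightarrow> nnf_sat v (mk_Or S) \<longleftrightarrow> (\<exists>C\<in>S. nnf_sat v C)"
  by (auto simp: mk_Or_def Abs_fset_inverse)

section \<open>Types realised in a structure\<close>

definition literal_atoms :: "'a literal set \<Rightarrow> 'a set" where
  "literal_atoms L = (\<Union>l\<in>L. set_literal l)"

lemma mem_literal_atoms: "p \<in> literal_atoms L \<longleftrightarrow> Pos p \<in> L \<or> NegL p \<in> L"
  unfolding literal_atoms_def
proof
  assume "p \<in> (\<Union>l\<in>L. set_literal l)"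
  then obtain l where "l \<in> L" "p \<in> set_literal l" by blast
  then show "Pos p \<in> L \<or> NegL p \<in> L" by (cases l) auto
qed force

lemma literal_atoms_Un: "literal_atoms (L \<union> L') = literal_atoms L \<union> literal_atoms L'"
  by (simp add: literal_atoms_def)

lemma literal_atoms_map: "literal_atoms (map_literal f ` L) = f ` literal_atoms L"
  by (simp add: literal_atoms_def literal.set_map image_UN)

text \<open>\<open>L\<close> contains a literal over \<open>p\<close>, and a literal false under
  \<open>v\<close> cannot belong to \<open>L\<close>. Thus a satisfiable context decides every atom
  that it mentions.\<close>

lemma literal_decided:
  assumes "\<forall>l\<in>L. holds v l" and "p \<in> literal_atoms L"
  shows "Pos p \<in> L \<longleftrightarrow> v p" and "NegL p \<in> L \<longleftrightarrow> \<not> v p"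
  using assms by (force simp: mem_literal_atoms)+

text \<open>Since \<open>L\<close> decides \<open>p\<close>, any single model of \<open>L\<close>
  settles the entailment. This turns entries of the satisfaction state into truth values in one
  structure.\<close>

lemma entails_atom_iff:
  assumes "\<forall>l\<in>L. holds v l" and "p \<in> literal_atoms L"
  shows "entails_atom L p \<longleftrightarrow> v p"
proof
  show "entails_atom L p \<Longrightarrow> v p"
    using assms(1) unfolding entails_atom_def by blast
  show "v p \<Longrightarrow> entails_atom L p"
    using literal_decided(1)[OF assms] by (force simp: entails_atom_def)
qed

lemma holds_map_literal: "holds v (map_literal f l) \<longleftrightarrow> holds (v \<circ> f) l"
  by (cases l) auto

text \<open>The diagram of \<open>v\<close> restricted to \<open>As\<close>; these sets turn out to
  be exactly the maximally consistent ones.\<close>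

definition realised :: "'a set \<Rightarrow> ('a \<Rightarrow> bool) \<Rightarrow> 'a literal set" where
  "realised As v = {l \<in> literals As. holds v l}"

lemma holds_realised: "(\<forall>l\<in>realised As v. holds w l) \<longleftrightarrow> (\<forall>p\<in>As. w p \<longleftrightarrow> v p)"
  by (auto simp: realised_def literals_def)

lemma literal_atoms_realised: "literal_atoms (realised As v) = As"
  by (auto simp: mem_literal_atoms realised_def literals_def)

lemma realised_cong: "(\<And>p. p \<in> As \<Longrightarrow> v p \<longleftrightarrow> w p) \<Longrightarrow> realised As v = realised As w"
  by (auto simp: realised_def literals_def)

lemma realised_consistent: "realised As v \<subseteq> literals As" "consistent (realised As v)"
  by (auto simp: realised_def consistent_def)

lemma subset_realised:
  assumes "L \<subseteq> literals As" and "consistent L"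
  obtains v where "L \<subseteq> realised As v"
  using assms by (auto simp: realised_def consistent_def)

text \<open>Each side has exactly one literal per atom of \<open>As\<close>, so neither can be
  properly contained in the other.\<close>

lemma realised_subset_iff: "realised As v \<subseteq> realised As w \<longleftrightarrow> realised As v = realised As w"
proof
  assume sub: "realised As v \<subseteq> realised As w"
  have "\<forall>l\<in>realised As w. holds w l"
    by (simp add: realised_def)
  then have "\<forall>p\<in>As. w p \<longleftrightarrow> v p"
    using sub unfolding holds_realised[of As v w, symmetric] by blast
  then show "realised As v = realised As w"
    by (intro realised_cong) simp
qed simp

text \<open>A consistent set lies inside the diagram of a valuation satisfying it, and diagrams are
  pairwise incomparable under inclusion. Types can therefore be read off structures.\<close>

lemma maximally_consistent_iff: "maximally_consistent As L \<longleftrightarrow> (\<exists>v. L = realised As v)"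
proof
  assume L: "maximally_consistent As L"
  then obtain v where "L \<subseteq> realised As v"
    unfolding maximally_consistent_def using subset_realised by metis
  then show "\<exists>v. L = realised As v"
    using L realised_consistent[of As v] unfolding maximally_consistent_def by blast
next
  assume "\<exists>v. L = realised As v"
  then obtain v where L: "L = realised As v" by blast
  have "L' = L" if L': "L \<subseteq> L'" "L' \<subseteq> literals As" "consistent L'" for L'
  proof -
    obtain w where w: "L' \<subseteq> realised As w"
      using subset_realised[OF L'(2,3)] .
    then have "L = realised As w"
      using L'(1) realised_subset_iff[of As v w] unfolding L by blast
    then show ?thesis
      using L'(1) w by blast
  qed
  then show "maximally_consistent As L"
    using L realised_consistent[of As v] unfolding maximally_consistent_def by blast
qed

section \<open>Unary and binary types of elements of a structure\<close>

definition utype where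
  "utype \<Gamma> A a = realised (unary_type_atoms (sentence \<Gamma>)) (A \<circ> inst (assign a a))"

definition btype where
  "btype \<Gamma> A a b = realised (binary_type_atoms (sentence \<Gamma>)) (A \<circ> inst (assign a b))"

lemma holds_inst1: "(\<forall>l\<in>inst1 \<tau> a. holds A l) \<longleftrightarrow> (\<forall>l\<in>\<tau>. holds (A \<circ> inst (assign a a)) l)"
  by (simp add: inst1_def holds_map_literal)

lemma holds_inst2: "(\<forall>l\<in>inst2 \<pi> a b. holds A l) \<longleftrightarrow> (\<forall>l\<in>\<pi>. holds (A \<circ> inst (assign a b)) l)"
  by (simp add: inst2_def holds_map_literal)

lemma holds_utype:
  "(\<forall>l\<in>inst1 (utype \<Gamma> A c) a. holds A' l) \<longleftrightarrow>
     (\<forall>P\<in>unary_preds (sentence \<Gamma>). A' (Unary P a) \<longleftrightarrow> A (Unary P c)) \<and>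
     (\<forall>R\<in>binary_preds (sentence \<Gamma>). A' (Binary R a a) \<longleftrightarrow> A (Binary R c c))"
  by (auto simp: holds_inst1 utype_def holds_realised unary_type_atoms_def ball_Un)

lemma holds_btype:
  "(\<forall>l\<in>inst2 (btype \<Gamma> A c d) a b. holds A' l) \<longleftrightarrow>
     (\<forall>R\<in>binary_preds (sentence \<Gamma>). (A' (Binary R a b) \<longleftrightarrow> A (Binary R c d)) \<and>
        (A' (Binary R b a) \<longleftrightarrow> A (Binary R d c)))"
  by (auto simp: holds_inst2 btype_def holds_realised binary_type_atoms_def ball_Un)

text \<open>At \<open>x = a\<close>, \<open>y = b\<close> the matrix can only query unary atoms and
  the binary atoms at \<open>(a, a)\<close>, \<open>(b, b)\<close>, \<open>(a, b)\<close>,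
  \<open>(b, a)\<close>. The two unary types and the binary type fix all of them, across
  structures.\<close>

lemma sat_matrix_if_same_types:
  assumes "quantifier_free (matrix \<Gamma>)"
    and "\<forall>l\<in>inst1 (utype \<Gamma> A c) a. holds A' l" and "\<forall>l\<in>inst1 (utype \<Gamma> A d) b. holds A' l"
    and "\<forall>l\<in>inst2 (btype \<Gamma> A c d) a b. holds A' l"
  shows "sat D' A' (assign a b) (matrix \<Gamma>) \<longleftrightarrow> sat D A (assign c d) (matrix \<Gamma>)"
    and "sat D' A' (assign b a) (matrix \<Gamma>) \<longleftrightarrow> sat D A (assign d c) (matrix \<Gamma>)"
proof -
  have "A' (Binary R (assign a b v) (assign a b w)) \<longleftrightarrow> A (Binary R (assign c d v) (assign c d w))"
    "A' (Binary R (assign b a v) (assign b a w)) \<longleftrightarrow> A (Binary R (assign d c v) (assign d c w))"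
    if "R \<in> binary_preds (sentence \<Gamma>)" for R v w
    using assms that unfolding holds_utype holds_btype by (cases v; cases w; simp)+
  moreover have "A' (Unary P (assign a b v)) \<longleftrightarrow> A (Unary P (assign c d v))"
    "A' (Unary P (assign b a v)) \<longleftrightarrow> A (Unary P (assign d c v))"
    if "P \<in> unary_preds (sentence \<Gamma>)" for P v
    using assms that unfolding holds_utype by (cases v; simp)+
  ultimately show "sat D' A' (assign a b) (matrix \<Gamma>) \<longleftrightarrow> sat D A (assign c d) (matrix \<Gamma>)"
    and "sat D' A' (assign b a) (matrix \<Gamma>) \<longleftrightarrow> sat D A (assign d c) (matrix \<Gamma>)"
    by (intro sat_matrix_cong assms(1); simp)+
qed

text \<open>Validity is entailment over all structures, but the types decide the matrix and
  \<open>A\<close> realises them; hence truth in \<open>A\<close> alone is equivalent.\<close>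

lemma btype_valid_iff:
  assumes "quantifier_free (matrix \<Gamma>)"
  shows "btype \<Gamma> A a b \<in> valid_binary_types \<Gamma> (utype \<Gamma> A a) (utype \<Gamma> A b) \<longleftrightarrow>
    sat D A (assign a b) (matrix \<Gamma>) \<and> sat D A (assign b a) (matrix \<Gamma>)"
    (is "?valid \<longleftrightarrow> ?sat")
proof
  assume ?sat
  have "sat D' B (assign c d) (matrix \<Gamma>) \<and> sat D' B (assign d c) (matrix \<Gamma>)"
    if types: "\<forall>l\<in>inst1 (utype \<Gamma> A a) c \<union> inst1 (utype \<Gamma> A b) d \<union> inst2 (btype \<Gamma> A a b) c d. holds B l"
    for D' :: "nat set" and B c d
  proof -
    have "\<forall>l\<in>inst1 (utype \<Gamma> A a) c. holds B l" "\<forall>l\<in>inst1 (utype \<Gamma> A b) d. holds B l"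
      "\<forall>l\<in>inst2 (btype \<Gamma> A a b) c d. holds B l"
      using types by (simp_all add: ball_Un)
    from sat_matrix_if_same_types[OF assms this, of D' D] show ?thesis
      using \<open>?sat\<close> by simp
  qed
  moreover have "binary_type \<Gamma> (btype \<Gamma> A a b)"
    unfolding binary_type_def maximally_consistent_iff btype_def by (rule exI) (rule refl)
  ultimately show ?valid
    by (simp only: valid_binary_types_def mem_Collect_eq) simp
next
  assume ?valid
  \<comment> \<open>validity only quantifies over structures on naturals, so \<open>a\<close> and \<open>b\<close> are renamed to 0 and 1\<close>
  define B where "B = A \<circ> inst (\<lambda>k::nat. if k = 0 then a else b)"
  have types: "\<forall>l\<in>inst1 (utype \<Gamma> A a) 0. holds B l" "\<forall>l\<in>inst1 (utype \<Gamma> A b) 1. holds B l"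
    "\<forall>l\<in>inst2 (btype \<Gamma> A a b) 0 1. holds B l"
    unfolding holds_utype holds_btype by (simp_all add: B_def)
  then have all_types:
    "\<forall>l\<in>inst1 (utype \<Gamma> A a) 0 \<union> inst1 (utype \<Gamma> A b) 1 \<union> inst2 (btype \<Gamma> A a b) 0 1. holds B l"
    by (simp only: ball_Un)
  have "\<forall>(D :: nat set) B. \<forall>c\<in>D. \<forall>d\<in>D.
      (\<forall>l\<in>inst1 (utype \<Gamma> A a) c \<union> inst1 (utype \<Gamma> A b) d \<union> inst2 (btype \<Gamma> A a b) c d. holds B l) \<longrightarrow>
      sat D B (assign c d) (matrix \<Gamma>) \<and> sat D B (assign d c) (matrix \<Gamma>)"
    using \<open>?valid\<close> unfolding valid_binary_types_def mem_Collect_eq by (rule conjunct2)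
  from this[THEN spec, THEN spec, THEN bspec, THEN bspec, THEN mp, OF _ _ all_types, of UNIV]
  show ?sat
    using sat_matrix_if_same_types[OF assms types, of UNIV D] by simp
qed

section \<open>Contexts of the recursive calls\<close>

text \<open>Binary types contain both orientations of each predicate, so listing a pair once as
  \<open>(l, t)\<close> also covers the atoms at \<open>(e t, e l)\<close>.\<close>

definition pair_atoms :: "('u, 'b) scott \<Rightarrow> (nat \<Rightarrow> 'e) \<Rightarrow> (nat \<times> nat) set \<Rightarrow> ('u, 'b, 'e) atom set" where
  "pair_atoms \<Gamma> e U = (\<Union>(l, t)\<in>U. inst (assign (e l) (e t)) ` binary_type_atoms (sentence \<Gamma>))"

definition element_atoms :: "('u, 'b) scott \<Rightarrow> (nat \<Rightarrow> 'e) \<Rightarrow> nat set \<Rightarrow> ('u, 'b, 'e) atom set" where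
  "element_atoms \<Gamma> e I = (\<Union>l\<in>I. inst (assign (e l) (e l)) ` unary_type_atoms (sentence \<Gamma>))"

lemma pair_atoms_insert:
  "pair_atoms \<Gamma> e (insert (l, t) U) =
     inst (assign (e l) (e t)) ` binary_type_atoms (sentence \<Gamma>) \<union> pair_atoms \<Gamma> e U"
  by (simp add: pair_atoms_def)

lemma Unary_notin_pair_atoms: "Unary P a \<notin> pair_atoms \<Gamma> e U"
  by (auto simp: pair_atoms_def binary_type_atoms_def)

text \<open>Injectivity of \<open>e\<close> recovers the indices from the arguments of the atom;
  only the orientation of the pair is lost.\<close>

lemma Binary_in_pair_atoms:
  assumes "inj_on e {1..n}" and "U \<subseteq> {1..n} \<times> {1..n}" and "a \<in> {1..n}" and "b \<in> {1..n}"
  shows "Binary R (e a) (e b) \<in> pair_atoms \<Gamma> e U \<longleftrightarrow>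
    R \<in> binary_preds (sentence \<Gamma>) \<and> ((a, b) \<in> U \<or> (b, a) \<in> U)"
proof
  assume "Binary R (e a) (e b) \<in> pair_atoms \<Gamma> e U"
  then obtain l t where lt: "(l, t) \<in> U" "R \<in> binary_preds (sentence \<Gamma>)"
    "e a = e l \<and> e b = e t \<or> e a = e t \<and> e b = e l"
    by (auto simp: pair_atoms_def binary_type_atoms_def)
  then have "a = l \<and> b = t \<or> a = t \<and> b = l"
    using assms by (auto dest!: inj_onD[OF assms(1)])
  then show "R \<in> binary_preds (sentence \<Gamma>) \<and> ((a, b) \<in> U \<or> (b, a) \<in> U)"
    using lt by auto
qed (force simp: pair_atoms_def binary_type_atoms_def)

section \<open>Order of the pairs and invariants of the calls\<close>

lemma unprocessed_subset: "unprocessed n ij \<subseteq> {(l, t). 1 \<le> l \<and> l < t \<and> t \<le> n}"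
  by (auto simp: unprocessed_def split: prod.splits)

lemma mem_unprocessed_first: "(l, t) \<in> unprocessed n (1, 2) \<longleftrightarrow> 1 \<le> l \<and> l < t \<and> t \<le> n"
  by (auto simp: unprocessed_def)

lemma unprocessed_next:
  assumes "1 \<le> i" "i < j" "j \<le> n"
  shows "unprocessed n (i, j) = insert (i, j) (unprocessed n (next_pair n (i, j)))"
    and "(i, j) \<notin> unprocessed n (next_pair n (i, j))"
  using assms by (auto simp: unprocessed_def next_pair_def)

text \<open>Extendability is claimed only for \<open>1 < i\<close>, because the initial empty
  context is never tested.\<close>

lemma stage1_call_literal_atoms:
  "stage1_call \<Gamma> e n i \<theta> \<Longrightarrow> 1 \<le> i \<and> (1 < i \<longrightarrow> extendable \<Gamma> e n \<theta>) \<and>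
     literal_atoms \<theta> = element_atoms \<Gamma> e {1..<i}"
proof (induction rule: stage1_call.induct)
  case 1
  then show ?case by (simp add: literal_atoms_def element_atoms_def)
next
  case (2 i \<theta> \<tau>)
  have "literal_atoms \<tau> = unary_type_atoms (sentence \<Gamma>)"
    using 2 by (auto simp: valid_unary_types_def unary_type_def maximally_consistent_iff
        literal_atoms_realised)
  then have "literal_atoms (inst1 \<tau> (e i)) = element_atoms \<Gamma> e {i}"
    by (simp add: inst1_def literal_atoms_map element_atoms_def)
  moreover have "{1..<i + 1} = {1..<i} \<union> {i}"
    using 2 by auto
  ultimately show ?case
    using 2 by (simp add: literal_atoms_Un) (simp add: element_atoms_def Un_commute)
qed

lemma literal_atoms_inst2:
  assumes "\<pi> \<in> valid_binary_types \<Gamma> \<tau> \<tau>'"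
  shows "literal_atoms (inst2 \<pi> a b) = inst (assign a b) ` binary_type_atoms (sentence \<Gamma>)"
  using assms by (auto simp: valid_binary_types_def binary_type_def maximally_consistent_iff
      literal_atoms_realised inst2_def literal_atoms_map)

text \<open>The bound \<open>snd ij \<le> n\<close> is conditional because the recursion ends at
  \<open>(n, n + 1)\<close>. The last part says that a context mentions exactly the atoms of the
  elements and of the processed pairs.\<close>

lemma stage2_call_invariant:
  assumes "stage2_call \<Gamma> e n ij \<theta>" and "n \<ge> 1"
  shows "1 \<le> fst ij \<and> fst ij < snd ij \<and> (fst ij < n \<longrightarrow> snd ij \<le> n)"
    and "extendable \<Gamma> e n \<theta>"
    and "literal_atoms \<theta> = element_atoms \<Gamma> e {1..n} \<union>
      pair_atoms \<Gamma> e (unprocessed n (1, 2) - unprocessed n ij)"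
proof -
  have "(1 \<le> fst ij \<and> fst ij < snd ij \<and> (fst ij < n \<longrightarrow> snd ij \<le> n)) \<and> extendable \<Gamma> e n \<theta> \<and>
    literal_atoms \<theta> = element_atoms \<Gamma> e {1..n} \<union>
      pair_atoms \<Gamma> e (unprocessed n (1, 2) - unprocessed n ij)"
    using assms(1)
  proof (induction rule: stage2_call.induct)
    case (1 \<theta>)
    have "pair_atoms \<Gamma> e {} = {}"
      by (simp add: pair_atoms_def)
    \<comment> \<open>As \<open>n \<ge> 1\<close>, stage I has made at least one choice, so its
      final context has passed the test.\<close>
    then show ?case
      using stage1_call_literal_atoms[OF 1] assms(2) by (auto simp: atLeastLessThanSuc_atLeastAtMost)
  next
    case (2 i j \<theta> \<pi>)
    then have ij: "1 \<le> i" "i < j" "j \<le> n" by auto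
    then have "unprocessed n (1, 2) - unprocessed n (next_pair n (i, j)) =
      insert (i, j) (unprocessed n (1, 2) - unprocessed n (i, j))"
      using unprocessed_next[OF ij] mem_unprocessed_first[of i j n] by auto
    then show ?case
      using 2 ij by (auto simp: literal_atoms_Un literal_atoms_inst2 pair_atoms_insert next_pair_def)
  qed
  then show "1 \<le> fst ij \<and> fst ij < snd ij \<and> (fst ij < n \<longrightarrow> snd ij \<le> n)"
    and "extendable \<Gamma> e n \<theta>"
    and "literal_atoms \<theta> = element_atoms \<Gamma> e {1..n} \<union>
      pair_atoms \<Gamma> e (unprocessed n (1, 2) - unprocessed n ij)"
    by auto
qed

text \<open>The context decides all unary type atoms of \<open>e a\<close>, so the type recorded in
  it is the one realised in any structure satisfying it.\<close>

lemma type_in_eq_utype: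
  assumes "stage2_call \<Gamma> e n ij \<theta>" and "n \<ge> 1" and "\<forall>l\<in>\<theta>. holds A l" and "a \<in> {1..n}"
  shows "type_in \<Gamma> \<theta> (e a) = utype \<Gamma> A (e a)"
proof -
  have "inst (assign (e a) (e a)) p \<in> literal_atoms \<theta>" if "p \<in> unary_type_atoms (sentence \<Gamma>)" for p
    using that assms(4) by (auto simp: stage2_call_invariant(3)[OF assms(1,2)] element_atoms_def)
  then show ?thesis
    using literal_decided[OF assms(3)]
    by (auto simp: type_in_def utype_def realised_def literals_def)
qed

section \<open>The circuits of stage II\<close>

text \<open>Induction along the recursion: the branch taken at \<open>(i, j)\<close> is the binary
  type of that pair in the model \<open>A\<close>.\<close>

lemma nnf_sat_stage2:
  assumes "quantifier_free (matrix \<Gamma>)" and "n \<ge> 1"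
  shows "stage2_call \<Gamma> e n ij \<theta> \<Longrightarrow> nnf_sat v (stage2 \<Gamma> e n ij \<theta>) \<longleftrightarrow>
    (\<exists>A. models (e ` {1..n}) A (sentence \<Gamma>) \<and> (\<forall>l\<in>\<theta>. holds A l) \<and>
      (\<forall>p\<in>pair_atoms \<Gamma> e (unprocessed n ij). A p \<longleftrightarrow> v p))"
  using assms
proof (induction \<Gamma> e n ij \<theta> rule: stage2.induct)
  case (1 \<Gamma> e n i j \<theta>)
  note call = 1(2) and qf = 1(3) and n = 1(4)
  note inv = stage2_call_invariant[OF call n]
  show ?case
  proof (cases "n \<le> i")
    case True
    \<comment> \<open>Nothing is left to agree on, and the model required to justify
      \<open>Top\<close> comes from the test passed by \<open>\<theta>\<close>.\<close>
    then have "unprocessed n (i, j) = {}"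
      by (auto simp: unprocessed_def)
    then show ?thesis
      using True inv(2) by (simp add: stage2.simps[of \<Gamma> e n i j \<theta>] pair_atoms_def extendable_def)
  next
    case False
    then have ij: "1 \<le> i" "i < j" "j \<le> n"
      using inv(1) by auto
    let ?\<theta> = "\<lambda>\<pi>. \<theta> \<union> inst2 \<pi> (e i) (e j)"
    define \<Pi> where "\<Pi> = {\<pi> \<in> valid_binary_types \<Gamma> (type_in \<Gamma> \<theta> (e i)) (type_in \<Gamma> \<theta> (e j)).
      extendable \<Gamma> e n (?\<theta> \<pi>)}"
    have fin: "finite \<Pi>"
      unfolding \<Pi>_def using finite_valid_binary_types by (rule finite_subset[rotated]) auto
    have sat_iff: "nnf_sat v (stage2 \<Gamma> e n (i, j) \<theta>) \<longleftrightarrow>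
      (\<exists>\<pi>\<in>\<Pi>. (\<forall>l\<in>inst2 \<pi> (e i) (e j). holds v l) \<and>
        nnf_sat v (stage2 \<Gamma> e n (next_pair n (i, j)) (?\<theta> \<pi>)))"
    proof -
      have "finite (inst2 \<pi> (e i) (e j))" if "\<pi> \<in> \<Pi>" for \<pi>
        using that by (auto simp: \<Pi>_def inst2_def intro: finite_valid_type(2))
      then have And: "nnf_sat v (mk_And {mk_And (Lit ` inst2 \<pi> (e i) (e j)), C}) \<longleftrightarrow>
          (\<forall>l\<in>inst2 \<pi> (e i) (e j). holds v l) \<and> nnf_sat v C" if "\<pi> \<in> \<Pi>" for \<pi> C
        using that by (simp add: nnf_sat_mk_And)
      have "stage2 \<Gamma> e n (i, j) \<theta> =
          mk_Or ((\<lambda>\<pi>. mk_And {mk_And (Lit ` inst2 \<pi> (e i) (e j)),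
            stage2 \<Gamma> e n (next_pair n (i, j)) (?\<theta> \<pi>)}) ` \<Pi>)"
        unfolding stage2.simps[of \<Gamma> e n i j \<theta>] \<Pi>_def using False by (simp only: if_False)
      then show ?thesis
        using fin And by (simp add: nnf_sat_mk_Or)
    qed
    have IH: "nnf_sat v (stage2 \<Gamma> e n (next_pair n (i, j)) (?\<theta> \<pi>)) \<longleftrightarrow>
      (\<exists>A. models (e ` {1..n}) A (sentence \<Gamma>) \<and> (\<forall>l\<in>?\<theta> \<pi>. holds A l) \<and>
        (\<forall>p\<in>pair_atoms \<Gamma> e (unprocessed n (next_pair n (i, j))). A p \<longleftrightarrow> v p))" if "\<pi> \<in> \<Pi>" for \<pi>
    proof (rule 1(1))
      show "stage2_call \<Gamma> e n (next_pair n (i, j)) (?\<theta> \<pi>)"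
        using that False stage2_call.intros(2)[OF call] by (simp add: \<Pi>_def)
    qed (use that False qf n in \<open>simp_all add: \<Pi>_def\<close>)
    show ?thesis
    proof
      assume "nnf_sat v (stage2 \<Gamma> e n (i, j) \<theta>)"
      then obtain \<pi> where \<pi>: "\<pi> \<in> \<Pi>" "\<forall>l\<in>inst2 \<pi> (e i) (e j). holds v l"
        and sat: "nnf_sat v (stage2 \<Gamma> e n (next_pair n (i, j)) (?\<theta> \<pi>))"
        unfolding sat_iff by blast
      obtain A where A: "models (e ` {1..n}) A (sentence \<Gamma>)" "\<forall>l\<in>?\<theta> \<pi>. holds A l"
          "\<forall>p\<in>pair_atoms \<Gamma> e (unprocessed n (next_pair n (i, j))). A p \<longleftrightarrow> v p"
        using sat unfolding IH[OF \<pi>(1)] by blast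
      \<comment> \<open>Both \<open>A\<close> and \<open>v\<close> satisfy \<open>\<pi>\<close>,
        which decides all atoms of the pair \<open>(i, j)\<close>; so they agree there too.\<close>
      have "\<forall>l\<in>inst2 \<pi> (e i) (e j). holds A l"
        using A(2) by (simp add: ball_Un)
      then have "A p \<longleftrightarrow> v p" if "p \<in> literal_atoms (inst2 \<pi> (e i) (e j))" for p
        using literal_decided(1)[OF _ that] \<pi>(2) by blast
      moreover have "literal_atoms (inst2 \<pi> (e i) (e j)) =
          inst (assign (e i) (e j)) ` binary_type_atoms (sentence \<Gamma>)"
        using \<pi>(1) unfolding \<Pi>_def by (intro literal_atoms_inst2) blast
      ultimately have "\<forall>p\<in>pair_atoms \<Gamma> e (unprocessed n (i, j)). A p \<longleftrightarrow> v p"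
        using A(3) unfolding unprocessed_next(1)[OF ij] pair_atoms_insert by blast
      then show "\<exists>A. models (e ` {1..n}) A (sentence \<Gamma>) \<and> (\<forall>l\<in>\<theta>. holds A l) \<and>
        (\<forall>p\<in>pair_atoms \<Gamma> e (unprocessed n (i, j)). A p \<longleftrightarrow> v p)"
        using A(1,2) by blast
    next
      assume "\<exists>A. models (e ` {1..n}) A (sentence \<Gamma>) \<and> (\<forall>l\<in>\<theta>. holds A l) \<and>
        (\<forall>p\<in>pair_atoms \<Gamma> e (unprocessed n (i, j)). A p \<longleftrightarrow> v p)"
      then obtain A where A: "models (e ` {1..n}) A (sentence \<Gamma>)" "\<forall>l\<in>\<theta>. holds A l"
        "\<forall>p\<in>pair_atoms \<Gamma> e (unprocessed n (i, j)). A p \<longleftrightarrow> v p" by blast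
      \<comment> \<open>The branch to follow is the binary type realised in \<open>A\<close>: it is
        valid because \<open>A\<close> satisfies the matrix, and \<open>A\<close> itself witnesses
        extendability.\<close>
      define \<pi> where "\<pi> = btype \<Gamma> A (e i) (e j)"
      have A\<pi>: "\<forall>l\<in>?\<theta> \<pi>. holds A l"
        using A(2) unfolding ball_Un \<pi>_def holds_btype by simp
      have "models (e ` {1..n}) A (sentence \<Gamma>) \<longleftrightarrow>
        (\<forall>a\<in>e ` {1..n}. \<forall>b\<in>e ` {1..n}. sat (e ` {1..n}) A (assign a b) (matrix \<Gamma>)) \<and>
        (\<forall>\<beta>\<in>set (witnesses \<Gamma>). \<forall>a\<in>e ` {1..n}. \<exists>b\<in>e ` {1..n}. A (inst (assign a b) \<beta>))"
        using n by (intro models_sentence) auto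
      then have "\<pi> \<in> valid_binary_types \<Gamma> (utype \<Gamma> A (e i)) (utype \<Gamma> A (e j))"
        unfolding \<pi>_def btype_valid_iff[OF qf, where D = "e ` {1..n}"]
        using A(1) ij by auto
      then have \<pi>: "\<pi> \<in> \<Pi>"
        using type_in_eq_utype[OF call n A(2)] ij A(1) A\<pi> by (auto simp: \<Pi>_def extendable_def)
      have "\<forall>l\<in>inst2 \<pi> (e i) (e j). holds v l"
        using A(3) unfolding unprocessed_next(1)[OF ij] pair_atoms_insert \<pi>_def holds_btype
        by (simp add: binary_type_atoms_def ball_Un)
      moreover have "nnf_sat v (stage2 \<Gamma> e n (next_pair n (i, j)) (?\<theta> \<pi>))"
        unfolding IH[OF \<pi>] using A A\<pi> unfolding unprocessed_next(1)[OF ij] pair_atoms_insert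
        by blast
      ultimately show "nnf_sat v (stage2 \<Gamma> e n (i, j) \<theta>)"
        using sat_iff \<pi> by blast
    qed
  qed
qed

text \<open>One half of the equivalence, so the hypotheses are an implication and an inclusion;
  exchanging the contexts gives the other half.\<close>

lemma nnf_sat_stage2_transfer:
  assumes snf: "scott_normal_form \<Gamma>" and n: "n \<ge> 1" and inj: "inj_on e {1..n}"
    and call: "stage2_call \<Gamma> e n ij \<theta>" and call': "stage2_call \<Gamma> e n ij \<theta>'"
    and state: "\<And>l k. l \<in> {1..n} \<Longrightarrow> k < length (witnesses \<Gamma>) \<Longrightarrow>
      satisfaction_state \<Gamma> e n \<theta> l k \<Longrightarrow> satisfaction_state \<Gamma> e n \<theta>' l k"
    and valid: "\<And>l t. (l, t) \<in> unprocessed n ij \<Longrightarrow>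
      valid_binary_types \<Gamma> (type_in \<Gamma> \<theta> (e l)) (type_in \<Gamma> \<theta> (e t)) \<subseteq>
      valid_binary_types \<Gamma> (type_in \<Gamma> \<theta>' (e l)) (type_in \<Gamma> \<theta>' (e t))"
    and sat: "nnf_sat v (stage2 \<Gamma> e n ij \<theta>)"
  shows "nnf_sat v (stage2 \<Gamma> e n ij \<theta>')"
proof -
  have qf: "quantifier_free (matrix \<Gamma>)"
    using snf by (simp add: scott_normal_form_def)
  let ?D = "e ` {1..n}"
  have models_iff: "models ?D A (sentence \<Gamma>) \<longleftrightarrow>
      (\<forall>a\<in>{1..n}. \<forall>b\<in>{1..n}. sat ?D A (assign (e a) (e b)) (matrix \<Gamma>)) \<and>
      (\<forall>\<beta>\<in>set (witnesses \<Gamma>). \<forall>a\<in>{1..n}. \<exists>b\<in>{1..n}. A (inst (assign (e a) (e b)) \<beta>))" for A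
    using n by (subst models_sentence) auto
  define U where "U = unprocessed n ij"
  have U: "U \<subseteq> {1..n} \<times> {1..n}" "\<And>a b. (a, b) \<in> U \<Longrightarrow> a < b"
    using unprocessed_subset[of n ij] by (auto simp: U_def)
  note mem_pair_atoms = Binary_in_pair_atoms[OF inj U(1)]
  obtain A where A: "models ?D A (sentence \<Gamma>)" "\<forall>l\<in>\<theta>. holds A l"
    "\<forall>p\<in>pair_atoms \<Gamma> e U. A p \<longleftrightarrow> v p"
    using sat unfolding nnf_sat_stage2[OF qf n call] U_def by blast
  \<comment> \<open>\<open>M\<close> exists because \<open>\<theta>'\<close> passed the test. It
    supplies \<open>A'\<close> with all unary types and with the binary types of the processed
    pairs.\<close>
  obtain M where M: "models ?D M (sentence \<Gamma>)" "\<forall>l\<in>\<theta>'. holds M l"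
    using stage2_call_invariant(2)[OF call' n] by (auto simp: extendable_def)
  define A' where "A' p = (if p \<in> pair_atoms \<Gamma> e U then A p else M p)" for p
  \<comment> \<open>Replacing \<open>M\<close> by \<open>A\<close> on \<open>U\<close> leaves
    \<open>\<theta>'\<close> intact: its atoms concern one element or a processed pair, while pairs
    in \<open>U\<close> are unprocessed and strictly increasing.\<close>
  have disjoint: "p \<notin> pair_atoms \<Gamma> e U" if p: "p \<in> literal_atoms \<theta>'" for p
  proof -
    consider "p \<in> element_atoms \<Gamma> e {1..n}" | "p \<in> pair_atoms \<Gamma> e (unprocessed n (1, 2) - U)"
      using p by (auto simp: stage2_call_invariant(3)[OF call' n] U_def)
    then show ?thesis
    proof cases
      case 1
      then obtain a where a: "a \<in> {1..n}"
        "(\<exists>P. p = Unary P (e a)) \<or> (\<exists>R. p = Binary R (e a) (e a))"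
        by (auto simp: element_atoms_def unary_type_atoms_def)
      moreover have "(a, a) \<notin> U"
        using U(2)[of a a] by blast
      ultimately show ?thesis
        by (auto simp: mem_pair_atoms[OF a(1) a(1)] Unary_notin_pair_atoms)
    next
      case 2
      then obtain a b q where ab: "(a, b) \<in> unprocessed n (1, 2)" "(a, b) \<notin> U"
        and q: "q \<in> binary_type_atoms (sentence \<Gamma>)" "p = inst (assign (e a) (e b)) q"
        unfolding pair_atoms_def by blast
      from ab(1) have "a < b" and dom: "a \<in> {1..n}" "b \<in> {1..n}"
        unfolding mem_unprocessed_first by simp_all
      then have "(b, a) \<notin> U"
        using U(2)[of b a] by auto
      with ab(2) q show ?thesis
        by (auto simp: binary_type_atoms_def mem_pair_atoms[OF dom] mem_pair_atoms[OF dom(2,1)])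
    qed
  qed
  have A'\<theta>': "\<forall>l\<in>\<theta>'. holds A' l"
  proof
    fix l assume l: "l \<in> \<theta>'"
    have "A' p \<longleftrightarrow> M p" if "p \<in> literal_atoms \<theta>'" for p
      using disjoint[OF that] by (simp add: A'_def)
    moreover have "holds M l"
      using M(2) l by blast
    ultimately show "holds A' l"
      using l by (cases l) (simp_all add: mem_literal_atoms)
  qed
  \<comment> \<open>Here the binary type comes from \<open>A\<close> but the unary types come from
    \<open>M\<close>. The inclusion of valid binary types makes this mixture valid.\<close>
  have matrix_U: "sat ?D A' (assign (e a) (e b)) (matrix \<Gamma>) \<and> sat ?D A' (assign (e b) (e a)) (matrix \<Gamma>)"
    if "(a, b) \<in> U" for a b
  proof -
    have ab: "a \<in> {1..n}" "b \<in> {1..n}"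
      using that U by auto
    have "btype \<Gamma> A (e a) (e b) \<in> valid_binary_types \<Gamma> (utype \<Gamma> A (e a)) (utype \<Gamma> A (e b))"
      using A(1) ab unfolding btype_valid_iff[OF qf, where D = ?D] models_iff by blast
    moreover have "btype \<Gamma> A (e a) (e b) = btype \<Gamma> A' (e a) (e b)"
      unfolding btype_def using that
      by (intro realised_cong) (auto simp: A'_def pair_atoms_def)
    ultimately have "btype \<Gamma> A' (e a) (e b) \<in> valid_binary_types \<Gamma> (utype \<Gamma> A' (e a)) (utype \<Gamma> A' (e b))"
      using valid[of a b] that ab type_in_eq_utype[OF call n A(2)] type_in_eq_utype[OF call' n A'\<theta>']
      by (auto simp: U_def)
    then show ?thesis
      unfolding btype_valid_iff[OF qf, where D = ?D] .
  qed
  have "sat ?D A' (assign (e a) (e b)) (matrix \<Gamma>)" if ab: "a \<in> {1..n}" "b \<in> {1..n}" for a b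
  proof (cases "(a, b) \<in> U \<or> (b, a) \<in> U")
    case True
    then show ?thesis using matrix_U by blast
  next
    case False
    \<comment> \<open>With reflexive atoms excluded as well, every atom the matrix can query at
      \<open>e a\<close>, \<open>e b\<close> lies outside \<open>U\<close>, where \<open>A'\<close>
      is \<open>M\<close>.\<close>
    have "(c, c) \<notin> U" for c
      using U(2) by blast
    then have "Binary R (assign (e a) (e b) x) (assign (e a) (e b) y) \<notin> pair_atoms \<Gamma> e U" for R x y
      using False ab by (cases x; cases y) (simp_all add: mem_pair_atoms)
    then have "sat ?D A' (assign (e a) (e b)) (matrix \<Gamma>) \<longleftrightarrow> sat ?D M (assign (e a) (e b)) (matrix \<Gamma>)"
      by (intro sat_matrix_cong qf) (auto simp: A'_def Unary_notin_pair_atoms)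
    then show ?thesis
      using M(1) ab unfolding models_iff by blast
  qed
  moreover have "\<exists>b\<in>{1..n}. A' (inst (assign (e a) (e b)) \<beta>)"
    if \<beta>: "\<beta> \<in> set (witnesses \<Gamma>)" and a: "a \<in> {1..n}" for \<beta> a
  proof -
    obtain b where b: "b \<in> {1..n}" "A (inst (assign (e a) (e b)) \<beta>)"
      using A(1) \<beta> a unfolding models_iff by blast
    let ?p = "inst (assign (e a) (e b)) \<beta>"
    show ?thesis
    proof (cases "?p \<in> pair_atoms \<Gamma> e U")
      case True
      then show ?thesis using b by (auto simp: A'_def)
    next
      case False
      \<comment> \<open>A witness in \<open>A\<close> that does not come from an unprocessed pair is
        decided by \<open>\<theta>\<close>, hence visible in its satisfaction state.\<close>
      have "?p \<in> literal_atoms \<theta>"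
      proof -
        obtain R x y where R: "\<beta> = Binary R x y" "R \<in> binary_preds (sentence \<Gamma>)"
          using snf \<beta> preds_witness unfolding scott_normal_form_def is_Binary_def by metis
        \<comment> \<open>The atom \<open>\<beta>\<close> may be \<open>R(x,y)\<close>,
          \<open>R(y,x)\<close>, \<open>R(x,x)\<close> or \<open>R(y,y)\<close>, so its ground
          arguments get names of their own.\<close>
        obtain c d where cd: "c \<in> {1..n}" "d \<in> {1..n}" "?p = Binary R (e c) (e d)"
          using a b(1) R(1) by (cases x; cases y) auto
        show ?thesis
        proof (cases "c = d")
          case True
          have "Binary R Vx Vx \<in> unary_type_atoms (sentence \<Gamma>)"
            using R(2) by (simp add: unary_type_atoms_def)
          then have "inst (assign (e c) (e c)) (Binary R Vx Vx) \<in> element_atoms \<Gamma> e {1..n}"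
            using cd(1) unfolding element_atoms_def by blast
          then show ?thesis
            using cd(3) True by (simp add: stage2_call_invariant(3)[OF call n])
        next
          case neq: False
          have "(c, d) \<in> unprocessed n (1, 2) - U \<or> (d, c) \<in> unprocessed n (1, 2) - U"
            using False cd(1,2) R(2) neq unfolding cd(3) mem_pair_atoms[OF cd(1,2)]
            by (auto simp: mem_unprocessed_first[unfolded One_nat_def])
          then have "?p \<in> pair_atoms \<Gamma> e (unprocessed n (1, 2) - U)"
            using R(2) cd by (force simp: pair_atoms_def binary_type_atoms_def)
          then show ?thesis
            by (simp add: stage2_call_invariant(3)[OF call n] U_def)
        qed
      qed
      then have "entails_atom \<theta> ?p"
        using entails_atom_iff[OF A(2)] b(2) by blast
      moreover obtain k where k: "k < length (witnesses \<Gamma>)" "\<beta> = witnesses \<Gamma> ! k"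
        using \<beta> by (auto simp: in_set_conv_nth)
      ultimately have "satisfaction_state \<Gamma> e n \<theta> a k"
        using b(1) unfolding satisfaction_state_def by blast
      then have "satisfaction_state \<Gamma> e n \<theta>' a k"
        using state[OF a k(1)] by blast
      \<comment> \<open>The witness given by the state of \<open>\<theta>'\<close> may differ from
        \<open>b\<close>; its atom is entailed by \<open>\<theta>'\<close> and so true in
        \<open>A'\<close>.\<close>
      then show ?thesis
        using A'\<theta>' k(2) by (auto simp: satisfaction_state_def entails_atom_def)
    qed
  qed
  ultimately have "models ?D A' (sentence \<Gamma>)"
    unfolding models_iff by blast
  moreover have "\<forall>p\<in>pair_atoms \<Gamma> e U. A' p \<longleftrightarrow> v p"
    using A(3) by (simp add: A'_def)
  ultimately show ?thesis
    using A'\<theta>' unfolding nnf_sat_stage2[OF qf n call'] U_def by blast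
qed

theorem proposition21:
  fixes \<Gamma> :: "('u, 'b) scott" and e :: "nat \<Rightarrow> 'e" and n i j :: nat
    and \<theta> \<theta>' :: "('u, 'b, 'e) ctxt"
  assumes "scott_normal_form \<Gamma>"
    and "n \<ge> 1" and "inj_on e {1..n}"
    and "stage2_call \<Gamma> e n (i, j) \<theta>" and "stage2_call \<Gamma> e n (i, j) \<theta>'"
    and "\<forall>l\<in>{1..n}. \<forall>k < length (witnesses \<Gamma>).
           satisfaction_state \<Gamma> e n \<theta> l k \<longleftrightarrow> satisfaction_state \<Gamma> e n \<theta>' l k"
    and "\<forall>(l, t) \<in> unprocessed n (i, j).
           valid_binary_types \<Gamma> (type_in \<Gamma> \<theta> (e l)) (type_in \<Gamma> \<theta> (e t)) =
           valid_binary_types \<Gamma> (type_in \<Gamma> \<theta>' (e l)) (type_in \<Gamma> \<theta>' (e t))"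
  shows "equivalent (stage2 \<Gamma> e n (i, j) \<theta>) (stage2 \<Gamma> e n (i, j) \<theta>')"
proof -
  have "nnf_sat v (stage2 \<Gamma> e n (i, j) \<theta>')" if "nnf_sat v (stage2 \<Gamma> e n (i, j) \<theta>)" for v
    by (rule nnf_sat_stage2_transfer[OF assms(1-5) _ _ that]) (use assms(6,7) in auto)
  moreover have "nnf_sat v (stage2 \<Gamma> e n (i, j) \<theta>)" if "nnf_sat v (stage2 \<Gamma> e n (i, j) \<theta>')" for v
    by (rule nnf_sat_stage2_transfer[OF assms(1-3,5,4) _ _ that]) (use assms(6,7) in auto)
  ultimately show ?thesis
    by (auto simp: equivalent_def)
qed

end
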